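(* Let $N\in\mathbb{N}$, $\mu\ge 0$, $\kappa>0$, and let $(\rho_{i,j},(\rho u)_{i,j},(\rho v)_{i,j})_{i,j=1,\dots,N}$, with $\rho_{i,j}>0$, be a differentiable-in-time solution, on some time interval, of the semidiscrete two-dimensional Navier-Stokes-Korteweg scheme with periodic boundary conditions given in the context, and write $\mathbf{u}_{i,j}=(u_{i,j},v_{i,j})^T$. Then the scheme conserves the total mass $\frac1{N^2}\sum_{i,j=1}^N\rho_{i,j}$ and the total momentum $\frac1{N^2}\sum_{i,j=1}^N\rho_{i,j}\mathbf{u}_{i,j}$; that is, on this time interval, $$\frac{d}{dt}\,\frac1{N^2}\sum_{i,j=1}^N\rho_{i,j}=0,\qquad \frac{d}{dt}\,\frac1{N^2}\sum_{i,j=1}^N\rho_{i,j}\mathbf{u}_{i,j}=0 .$$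
   Context: Grid and operators: $h=1/N$, square cells on the two-dimensional torus. Grid functions $\phi=(\phi_{i,j})$ are periodic: $\phi_{i+kN,j+lN}=\phi_{i,j}$ for all integers $k,l$. Define $$\nabla^c_x\phi_{i,j}=\frac{\phi_{i+1,j}-\phi_{i-1,j}}{2h},\quad \nabla^c_y\phi_{i,j}=\frac{\phi_{i,j+1}-\phi_{i,j-1}}{2h},$$ $$\nabla^\pm_x\phi_{i,j}=\pm\frac{\phi_{i\pm1,j}-\phi_{i,j}}{h},\quad \nabla^\pm_y\phi_{i,j}=\pm\frac{\phi_{i,j\pm1}-\phi_{i,j}}{h},$$ $$\Delta_h\phi_{i,j}=\frac{\phi_{i+1,j}-2\phi_{i,j}+\phi_{i-1,j}}{h^2}+\frac{\phi_{i,j+1}-2\phi_{i,j}+\phi_{i,j-1}}{h^2}.$$ Products of grid functions are pointwise, e.g. $(\rho u)_{i,j}=\rho_{i,j}u_{i,j}$, $(\rho uv)_{i,j}=\rho_{i,j}u_{i,j}v_{i,j}$. Data: $p$ is a continuously differentiable, strictly monotone pressure function on $(0,\infty)$ such that the first order part of the system is strictly hyperbolic (i.e. $p'>0$); $\mu\ge0$ is the constant viscosity and $\kappa>0$ the constant capillarity coefficient. Scheme (the unknowns are the functions of time $\rho_{i,j}>0$, $(\rho u)_{i,j}$, $(\rho v)_{i,j}$): $$-\frac{d}{dt}\rho_{i,j}=\nabla^c_x(\rho u)_{i,j}+\nabla^c_y(\rho v)_{i,j}-\lambda h\,\Delta_h\rho_{i,j},$$ $$\begin{aligned}-\frac{d}{dt}(\rho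 u)_{i,j}=&\ \nabla^c_x(\rho u^2)_{i,j}+\nabla^c_y(\rho uv)_{i,j}+\nabla^c_x p(\rho_{i,j})-\mu\Delta_h u_{i,j}-\lambda h\,\Delta_h(\rho u)_{i,j}\\&-\kappa\Big[\nabla^-_x\frac{\rho_{i,j}\Delta_h\rho_{i+1,j}+\rho_{i+1,j}\Delta_h\rho_{i,j}}{2}-\frac12\nabla^-_x(\nabla^+_x\rho_{i,j})^2\\&\qquad+\frac12\nabla^-_x\big(\nabla^-_y\rho_{i+1,j}\,\nabla^-_y\rho_{i,j}\big)-\nabla^-_y\big(\nabla^c_x\rho_{i,j}\,\nabla^+_y\rho_{i,j}\big)\Big],\end{aligned}$$ $$\begin{aligned}-\frac{d}{dt}(\rho v)_{i,j}=&\ \nabla^c_y(\rho v^2)_{i,j}+\nabla^c_x(\rho uv)_{i,j}+\nabla^c_y p(\rho_{i,j})-\mu\Delta_h v_{i,j}-\lambda h\,\Delta_h(\rho v)_{i,j}\\&-\kappa\Big[\nabla^-_y\frac{\rho_{i,j}\Delta_h\rho_{i,j+1}+\rho_{i,j+1}\Delta_h\rho_{i,j}}{2}-\frac12\nabla^-_y(\nabla^+_y\rho_{i,j})^2\\&\qquad+\frac12\nabla^-_y\big(\nabla^-_x\rho_{i,j+1}\,\nabla^-_x\rho_{i,j}\big)-\nabla^-_x\big(\nabla^c_y\rho_{i,j}\,\nabla^+_x\rho_{i,j}\big)\Big],\end{aligned}$$ where $\lambda\ge 0$ is the numerical dissipation parameter, at each time a number independent of $(i,j)$ (in the paper, $\lambda=\frac12\max_{i,j}\{|\mathbf{u}_{i,j}|+\sqrt{p'(\rho_{i,j})}\}$).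 *)

theory Defs
  imports "HOL-Analysis.Analysis"
begin

type_synonym grid_fun = "int \<Rightarrow> int \<Rightarrow> real"

definition periodic_grid :: "nat \<Rightarrow> grid_fun \<Rightarrow> bool" where
  "periodic_grid N \<phi> \<longleftrightarrow> (\<forall>i j k l. \<phi> (i + k * int N) (j + l * int N) = \<phi> i j)"

text \<open>
  Difference quotients with mesh width \<open>h\<close>: the letter \<open>c\<close>, \<open>p\<close>, \<open>m\<close> stands for central, forward
  (plus) and backward (minus), the last letter for the direction. Each operator maps grid functions
  to grid functions, so it acts on the whole expression given as its argument.
\<close>

definition Dcx :: "real \<Rightarrow> grid_fun \<Rightarrow> grid_fun" where
  "Dcx h \<phi> = (\<lambda>i j. (\<phi> (i + 1) j - \<phi> (i - 1) j) / (2 * h))"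

definition Dcy :: "real \<Rightarrow> grid_fun \<Rightarrow> grid_fun" where
  "Dcy h \<phi> = (\<lambda>i j. (\<phi> i (j + 1) - \<phi> i (j - 1)) / (2 * h))"

definition Dpx :: "real \<Rightarrow> grid_fun \<Rightarrow> grid_fun" where
  "Dpx h \<phi> = (\<lambda>i j. (\<phi> (i + 1) j - \<phi> i j) / h)"

definition Dpy :: "real \<Rightarrow> grid_fun \<Rightarrow> grid_fun" where
  "Dpy h \<phi> = (\<lambda>i j. (\<phi> i (j + 1) - \<phi> i j) / h)"

definition Dmx :: "real \<Rightarrow> grid_fun \<Rightarrow> grid_fun" where
  "Dmx h \<phi> = (\<lambda>i j. - ((\<phi> (i - 1) j - \<phi> i j) / h))"

definition Dmy :: "real \<Rightarrow> grid_fun \<Rightarrow> grid_fun" where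
  "Dmy h \<phi> = (\<lambda>i j. - ((\<phi> i (j - 1) - \<phi> i j) / h))"

definition Lap :: "real \<Rightarrow> grid_fun \<Rightarrow> grid_fun" where
  "Lap h \<phi> = (\<lambda>i j. (\<phi> (i + 1) j - 2 * \<phi> i j + \<phi> (i - 1) j) / h\<^sup>2
                 + (\<phi> i (j + 1) - 2 * \<phi> i j + \<phi> i (j - 1)) / h\<^sup>2)"

definition pressure_function :: "(real \<Rightarrow> real) \<Rightarrow> bool" where
  "pressure_function p \<longleftrightarrow>
     (\<forall>x>0. p differentiable (at x)) \<and> continuous_on {0<..} (deriv p) \<and>
     strict_mono_on {0<..} p \<and> (\<forall>x>0. deriv p x > 0)"

definition korteweg_x :: "real \<Rightarrow> grid_fun \<Rightarrow> grid_fun" where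
  "korteweg_x h \<rho> = (\<lambda>i j.
       Dmx h (\<lambda>i j. (\<rho> i j * Lap h \<rho> (i + 1) j + \<rho> (i + 1) j * Lap h \<rho> i j) / 2) i j
     - 1 / 2 * Dmx h (\<lambda>i j. (Dpx h \<rho> i j)\<^sup>2) i j
     + 1 / 2 * Dmx h (\<lambda>i j. Dmy h \<rho> (i + 1) j * Dmy h \<rho> i j) i j
     - Dmy h (\<lambda>i j. Dcx h \<rho> i j * Dpy h \<rho> i j) i j)"

definition korteweg_y :: "real \<Rightarrow> grid_fun \<Rightarrow> grid_fun" where
  "korteweg_y h \<rho> = (\<lambda>i j.
       Dmy h (\<lambda>i j. (\<rho> i j * Lap h \<rho> i (j + 1) + \<rho> i (j + 1) * Lap h \<rho> i j) / 2) i j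
     - 1 / 2 * Dmy h (\<lambda>i j. (Dpy h \<rho> i j)\<^sup>2) i j
     + 1 / 2 * Dmy h (\<lambda>i j. Dmx h \<rho> i (j + 1) * Dmx h \<rho> i j) i j
     - Dmx h (\<lambda>i j. Dcy h \<rho> i j * Dpx h \<rho> i j) i j)"

text \<open>
  The three grid functions below are the right-hand sides of the scheme, which is written
  as \<open>- d/dt (unknown) = right-hand side\<close>.
\<close>

definition mass_rhs :: "real \<Rightarrow> real \<Rightarrow> grid_fun \<Rightarrow> grid_fun \<Rightarrow> grid_fun \<Rightarrow> grid_fun" where
  "mass_rhs h lam \<rho> u v = (\<lambda>i j.
       Dcx h (\<lambda>i j. \<rho> i j * u i j) i j + Dcy h (\<lambda>i j. \<rho> i j * v i j) i j
     - lam * h * Lap h \<rho> i j)"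

definition momentum_x_rhs ::
  "real \<Rightarrow> real \<Rightarrow> real \<Rightarrow> real \<Rightarrow> (real \<Rightarrow> real) \<Rightarrow> grid_fun \<Rightarrow> grid_fun \<Rightarrow> grid_fun \<Rightarrow> grid_fun" where
  "momentum_x_rhs h \<mu> \<kappa> lam p \<rho> u v = (\<lambda>i j.
       Dcx h (\<lambda>i j. \<rho> i j * (u i j)\<^sup>2) i j + Dcy h (\<lambda>i j. \<rho> i j * u i j * v i j) i j
     + Dcx h (\<lambda>i j. p (\<rho> i j)) i j - \<mu> * Lap h u i j
     - lam * h * Lap h (\<lambda>i j. \<rho> i j * u i j) i j
     - \<kappa> * korteweg_x h \<rho> i j)"

definition momentum_y_rhs ::
  "real \<Rightarrow> real \<Rightarrow> real \<Rightarrow> real \<Rightarrow> (real \<Rightarrow> real) \<Rightarrow> grid_fun \<Rightarrow> grid_fun \<Rightarrow> grid_fun \<Rightarrow> grid_fun" where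
  "momentum_y_rhs h \<mu> \<kappa> lam p \<rho> u v = (\<lambda>i j.
       Dcy h (\<lambda>i j. \<rho> i j * (v i j)\<^sup>2) i j + Dcx h (\<lambda>i j. \<rho> i j * u i j * v i j) i j
     + Dcy h (\<lambda>i j. p (\<rho> i j)) i j - \<mu> * Lap h v i j
     - lam * h * Lap h (\<lambda>i j. \<rho> i j * v i j) i j
     - \<kappa> * korteweg_y h \<rho> i j)"

text \<open>
  The differentiable quantities are \<open>\<rho>\<close>, \<open>\<rho> u\<close> and \<open>\<rho> v\<close>; as \<open>\<rho>\<close> is positive, they
  determine the velocities \<open>u\<close> and \<open>v\<close>. Derivatives are taken within \<open>T\<close>, so they are
  one-sided at an endpoint of the time interval that belongs to it. The dissipation parameter
  \<open>lam\<close> is a function of time, but independent of the cell.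
\<close>

definition NSK_solution ::
  "nat \<Rightarrow> real \<Rightarrow> real \<Rightarrow> (real \<Rightarrow> real) \<Rightarrow> (real \<Rightarrow> real) \<Rightarrow> real set \<Rightarrow>
   (real \<Rightarrow> grid_fun) \<Rightarrow> (real \<Rightarrow> grid_fun) \<Rightarrow> (real \<Rightarrow> grid_fun) \<Rightarrow> bool" where
  "NSK_solution N \<mu> \<kappa> lam p T \<rho> u v \<longleftrightarrow>
     (let h = 1 / real N in
      \<forall>t\<in>T. periodic_grid N (\<rho> t) \<and> periodic_grid N (u t) \<and> periodic_grid N (v t) \<and>
        (\<forall>i j. \<rho> t i j > 0 \<and>
          ((\<lambda>s. \<rho> s i j) has_real_derivative
             - mass_rhs h (lam t) (\<rho> t) (u t) (v t) i j) (at t within T) \<and>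
          ((\<lambda>s. \<rho> s i j * u s i j) has_real_derivative
             - momentum_x_rhs h \<mu> \<kappa> (lam t) p (\<rho> t) (u t) (v t) i j) (at t within T) \<and>
          ((\<lambda>s. \<rho> s i j * v s i j) has_real_derivative
             - momentum_y_rhs h \<mu> \<kappa> (lam t) p (\<rho> t) (u t) (v t) i j) (at t within T)))"

end

theory Submission
  imports Defs
begin

text \<open>
  Every term on the right-hand sides is a first difference or a discrete Laplacian, hence a linear
  combination of shifts whose coefficients add up to zero, applied to a periodic grid function.
  Since the sum of a periodic grid function over one period is invariant under shifts, the
  right-hand sides sum to zero.
\<close>

abbreviation grid_sum :: "nat \<Rightarrow> grid_fun \<Rightarrow> real" where
  "grid_sum N \<phi> \<equiv> (\<Sum>i=1..int N. \<Sum>j=1..int N. \<phi> i j)"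

lemma periodic_gridD: "periodic_grid N \<phi> \<Longrightarrow> \<phi> (i + k * int N) (j + l * int N) = \<phi> i j"
  by (simp add: periodic_grid_def)

lemma periodic_grid_shift:
  assumes "periodic_grid N \<phi>"
  shows "periodic_grid N (\<lambda>i j. \<phi> (i + a) (j + b))"
  using assms unfolding periodic_grid_def by (metis (no_types, opaque_lifting) add.assoc add.commute)

lemma periodic_grid_shifts:
  assumes "periodic_grid N \<phi>"
  shows "periodic_grid N (\<lambda>i j. \<phi> (i + 1) j)" "periodic_grid N (\<lambda>i j. \<phi> (i - 1) j)"
    "periodic_grid N (\<lambda>i j. \<phi> i (j + 1))" "periodic_grid N (\<lambda>i j. \<phi> i (j - 1))"
  using periodic_grid_shift[OF assms, of 1 0] periodic_grid_shift[OF assms, of "-1" 0]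
    periodic_grid_shift[OF assms, of 0 1] periodic_grid_shift[OF assms, of 0 "-1"] by simp_all

lemma periodic_grid_compose: "periodic_grid N \<phi> \<Longrightarrow> periodic_grid N (\<lambda>i j. f (\<phi> i j))"
  by (simp add: periodic_grid_def)

lemma periodic_grid_compose2:
  "periodic_grid N \<phi> \<Longrightarrow> periodic_grid N \<psi> \<Longrightarrow> periodic_grid N (\<lambda>i j. f (\<phi> i j) (\<psi> i j))"
  by (simp add: periodic_grid_def)

text \<open>With a variable \<open>f\<close> the closure rules are not higher-order patterns. Fixing
  \<open>f\<close> to each operation of the scheme gives rewrite rules that take an expression apart
  at its outermost operation.\<close>

lemmas periodic_grid_arith =
  periodic_grid_compose2[of _ _ _ "(+)"] periodic_grid_compose2[of _ _ _ "(-)"]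
  periodic_grid_compose2[of _ _ _ "(*)"] periodic_grid_compose[of _ _ "\<lambda>x. x\<^sup>2"]
  periodic_grid_compose[of _ _ uminus] periodic_grid_compose[of _ _ "\<lambda>x. c * x" for c]
  periodic_grid_compose[of _ _ "\<lambda>x. x / c" for c]

lemma periodic_grid_differences:
  assumes "periodic_grid N \<phi>"
  shows "periodic_grid N (Dcx h \<phi>)" "periodic_grid N (Dcy h \<phi>)" "periodic_grid N (Dpx h \<phi>)"
    "periodic_grid N (Dpy h \<phi>)" "periodic_grid N (Dmx h \<phi>)" "periodic_grid N (Dmy h \<phi>)"
    "periodic_grid N (Lap h \<phi>)"
  unfolding Dcx_def Dcy_def Dpx_def Dpy_def Dmx_def Dmy_def Lap_def
  by (simp_all add: periodic_grid_arith periodic_grid_shifts[OF assms] assms)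

text \<open>The difference of the two sums telescopes to \<open>f (1 + int N) - f 1\<close>, which
  periodicity makes zero.\<close>

lemma sum_periodic_shift:
  fixes f :: "int \<Rightarrow> real"
  assumes "\<And>i. f (i + int N) = f i"
  shows "(\<Sum>i=1..int N. f (i + 1)) = (\<Sum>i=1..int N. f i)"
proof -
  \<comment> \<open>The period \<open>N\<close> is fixed, so the induction runs over a separate
    upper bound \<open>n\<close> and does not use periodicity.\<close>
  have "(\<Sum>i=1..int n. f (i + 1) - f i) = f (1 + int n) - f 1" for n
  proof (induction n)
    case (Suc n)
    have "{1..int (Suc n)} = insert (int n + 1) {1..int n}"
      by auto
    with Suc show ?case
      by (simp add: algebra_simps)
  qed simp
  from this[of N] show ?thesis
    by (simp add: assms[of 1] sum_subtractf)
qed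

lemma grid_sum_shift:
  assumes "periodic_grid N \<phi>"
  shows "grid_sum N (\<lambda>i j. \<phi> (i + 1) j) = grid_sum N \<phi>"
    and "grid_sum N (\<lambda>i j. \<phi> i (j + 1)) = grid_sum N \<phi>"
    and "grid_sum N (\<lambda>i j. \<phi> (i - 1) j) = grid_sum N \<phi>"
    and "grid_sum N (\<lambda>i j. \<phi> i (j - 1)) = grid_sum N \<phi>"
proof -
  \<comment> \<open>Stated for every periodic \<open>\<psi>\<close>: taking the backward shift of
    \<open>\<phi>\<close> as \<open>\<psi>\<close> turns the forward statement into the backward
    one. In the x direction the row sum over \<open>j\<close> is itself a periodic function of
    \<open>i\<close>.\<close>
  have x: "grid_sum N (\<lambda>i j. \<psi> (i + 1) j) = grid_sum N \<psi>" if "periodic_grid N \<psi>" for \<psi>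
    using periodic_gridD[OF that, of _ 1 _ 0]
    by (intro sum_periodic_shift[where f = "\<lambda>i. \<Sum>j=1..int N. \<psi> i j"]) simp
  have y: "grid_sum N (\<lambda>i j. \<psi> i (j + 1)) = grid_sum N \<psi>" if "periodic_grid N \<psi>" for \<psi>
    using periodic_gridD[OF that, of _ 0 _ 1] by (intro sum.cong refl sum_periodic_shift) simp
  show "grid_sum N (\<lambda>i j. \<phi> (i + 1) j) = grid_sum N \<phi>"
    "grid_sum N (\<lambda>i j. \<phi> i (j + 1)) = grid_sum N \<phi>"
    using assms by (rule x y)+
  show "grid_sum N (\<lambda>i j. \<phi> (i - 1) j) = grid_sum N \<phi>"
    using x[OF periodic_grid_shifts(2)[OF assms]] by simp
  show "grid_sum N (\<lambda>i j. \<phi> i (j - 1)) = grid_sum N \<phi>"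
    using y[OF periodic_grid_shifts(4)[OF assms]] by simp
qed

text \<open>Forward differences are absent because the scheme has them only inside the argument of
  an outer backward difference.\<close>

lemma grid_sum_differences:
  assumes "periodic_grid N \<phi>"
  shows "grid_sum N (Dcx h \<phi>) = 0" "grid_sum N (Dcy h \<phi>) = 0" "grid_sum N (Dmx h \<phi>) = 0"
    "grid_sum N (Dmy h \<phi>) = 0" "grid_sum N (Lap h \<phi>) = 0"
  unfolding Dcx_def Dcy_def Dmx_def Dmy_def Lap_def
  by (simp_all add: sum.distrib sum_subtractf sum_negf grid_sum_shift[OF assms]
      flip: sum_divide_distrib sum_distrib_left)

text \<open>The capillarity terms are in conservative form: each is a multiple of an outer backward
  difference of some flux, so only the periodicity of the fluxes has to be checked. The fluxes
  contain shifted copies of \<open>Dmx h \<rho>\<close>, \<open>Dmy h \<rho>\<close> and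
  \<open>Lap h \<rho>\<close>.\<close>

lemma grid_sum_korteweg:
  assumes "periodic_grid N \<rho>"
  shows "grid_sum N (korteweg_x h \<rho>) = 0" and "grid_sum N (korteweg_y h \<rho>) = 0"
  unfolding korteweg_x_def korteweg_y_def sum.distrib sum_subtractf sum_distrib_left[symmetric]
  by (simp_all add: grid_sum_differences periodic_grid_arith periodic_grid_differences assms
      periodic_grid_shifts[OF assms] periodic_grid_shifts[OF periodic_grid_differences(5)[OF assms]]
      periodic_grid_shifts[OF periodic_grid_differences(6)[OF assms]]
      periodic_grid_shifts[OF periodic_grid_differences(7)[OF assms]])

text \<open>The coefficients, \<open>lam\<close> included, are the same in all cells and factor out
  of the sums. The pressure enters only through the periodicity of its composition with
  \<open>\<rho>\<close>.\<close>

lemma grid_sum_rhs: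
  assumes "periodic_grid N \<rho>" "periodic_grid N u" "periodic_grid N v"
  shows "grid_sum N (mass_rhs h lam \<rho> u v) = 0"
    and "grid_sum N (momentum_x_rhs h \<mu> \<kappa> lam p \<rho> u v) = 0"
    and "grid_sum N (momentum_y_rhs h \<mu> \<kappa> lam p \<rho> u v) = 0"
  unfolding mass_rhs_def momentum_x_rhs_def momentum_y_rhs_def
    sum.distrib sum_subtractf sum_distrib_left[symmetric]
  by (simp_all add: grid_sum_korteweg grid_sum_differences periodic_grid_arith
      periodic_grid_compose[of _ _ p] assms)

text \<open>Differentiation commutes with the finite sum. \<open>R\<close> is the right-hand side
  frozen at time \<open>t\<close>, and \<open>c\<close> will be the normalisation of the
  mean.\<close>

lemma grid_sum_has_derivative_zero:
  assumes "\<And>i j. ((\<lambda>s. f s i j) has_real_derivative - R i j) (at t within T)"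
    and "grid_sum N R = 0"
  shows "((\<lambda>s. c * grid_sum N (f s)) has_real_derivative 0) (at t within T)"
proof -
  have "((\<lambda>s. c * grid_sum N (f s)) has_real_derivative c * grid_sum N (\<lambda>i j. - R i j))
      (at t within T)"
    by (intro DERIV_cmult DERIV_sum assms(1))
  then show ?thesis
    by (simp add: sum_negf assms(2))
qed

text \<open>Constant basis vectors reduce the vector derivative of the momentum to two scalar
  derivatives.\<close>

lemma vector_2_eq_scaleR: "(vector [a, b] :: real ^ 2) = a *\<^sub>R vector [1, 0] + b *\<^sub>R vector [0, 1]"
  by (simp add: vec_eq_iff forall_2)

theorem theorem4:
  fixes N :: nat and \<mu> \<kappa> :: real and lam p :: "real \<Rightarrow> real"
    and T :: "real set" and \<rho> u v :: "real \<Rightarrow> grid_fun"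
  assumes "N \<ge> 1" and "\<mu> \<ge> 0" and "\<kappa> > 0"
    and "pressure_function p"
    and "is_interval T"
    and "\<And>t. t \<in> T \<Longrightarrow> lam t \<ge> 0"
    and "NSK_solution N \<mu> \<kappa> lam p T \<rho> u v"
  shows "\<forall>t\<in>T.
    ((\<lambda>s. 1 / (real N)\<^sup>2 * (\<Sum>i=1..int N. \<Sum>j=1..int N. \<rho> s i j))
       has_real_derivative 0) (at t within T) \<and>
    ((\<lambda>s. (1 / (real N)\<^sup>2) *\<^sub>R
         (\<Sum>i=1..int N. \<Sum>j=1..int N. \<rho> s i j *\<^sub>R (vector [u s i j, v s i j] :: real ^ 2)))
       has_vector_derivative 0) (at t within T)"
proof
  fix t assume "t \<in> T"
  define h where "h = 1 / real N"
  have per: "periodic_grid N (\<rho> t)" "periodic_grid N (u t)" "periodic_grid N (v t)"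
    and mass: "\<And>i j. ((\<lambda>s. \<rho> s i j) has_real_derivative
      - mass_rhs h (lam t) (\<rho> t) (u t) (v t) i j) (at t within T)"
    and mx: "\<And>i j. ((\<lambda>s. \<rho> s i j * u s i j) has_real_derivative
      - momentum_x_rhs h \<mu> \<kappa> (lam t) p (\<rho> t) (u t) (v t) i j) (at t within T)"
    and my: "\<And>i j. ((\<lambda>s. \<rho> s i j * v s i j) has_real_derivative
      - momentum_y_rhs h \<mu> \<kappa> (lam t) p (\<rho> t) (u t) (v t) i j) (at t within T)"
    using assms(7) \<open>t \<in> T\<close> by (simp_all add: NSK_solution_def Let_def h_def)
  define c where "c = 1 / (real N)\<^sup>2"
  note zero = grid_sum_has_derivative_zero[where c = c]
  have vec: "c *\<^sub>R (\<Sum>i=1..int N. \<Sum>j=1..int N. \<rho> s i j *\<^sub>R (vector [u s i j, v s i j] :: real ^ 2))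
      = (c * grid_sum N (\<lambda>i j. \<rho> s i j * u s i j)) *\<^sub>R vector [1, 0]
      + (c * grid_sum N (\<lambda>i j. \<rho> s i j * v s i j)) *\<^sub>R vector [0, 1]" for s
    \<comment> \<open>A single substitution, because the right-hand side of the equation again
      contains instances of its left-hand side and rewriting would loop.\<close>
    by (subst vector_2_eq_scaleR)
      (simp add: scaleR_add_right sum.distrib flip: scaleR_sum_left)
  \<comment> \<open>The derivative is left in the shape produced by the product rule: in each
    product both the basis vector and the scalar mean have derivative zero.\<close>
  have "((\<lambda>s. (c * grid_sum N (\<lambda>i j. \<rho> s i j * u s i j)) *\<^sub>R (vector [1, 0] :: real ^ 2)
      + (c * grid_sum N (\<lambda>i j. \<rho> s i j * v s i j)) *\<^sub>R vector [0, 1])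
      has_vector_derivative
        (c * grid_sum N (\<lambda>i j. \<rho> t i j * u t i j)) *\<^sub>R 0 + 0 *\<^sub>R vector [1, 0]
      + ((c * grid_sum N (\<lambda>i j. \<rho> t i j * v t i j)) *\<^sub>R 0 + 0 *\<^sub>R vector [0, 1]))
      (at t within T)"
    by (intro has_vector_derivative_add has_vector_derivative_scaleR has_vector_derivative_const
        zero[OF mx grid_sum_rhs(2)[OF per]] zero[OF my grid_sum_rhs(3)[OF per]])
  then show "((\<lambda>s. 1 / (real N)\<^sup>2 * (\<Sum>i=1..int N. \<Sum>j=1..int N. \<rho> s i j))
       has_real_derivative 0) (at t within T) \<and>
    ((\<lambda>s. (1 / (real N)\<^sup>2) *\<^sub>R
         (\<Sum>i=1..int N. \<Sum>j=1..int N. \<rho> s i j *\<^sub>R (vector [u s i j, v s i j] :: real ^ 2)))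
       has_vector_derivative 0) (at t within T)"
    using zero[OF mass grid_sum_rhs(1)[OF per]] by (simp add: vec flip: c_def)
qed

end
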